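(* Let $m,n$ be positive integers and let $(S,T)$ be a pair of random variables on a common probability space taking values in $\{0,1,\dots,m\}\times\{0,1,\dots,n\}$. Put $P_{(u,v)}=P(S\ge u,T\ge v)$ and $S_{i,j}=E\left[\binom{S}{i}\binom{T}{j}\right]$. Then for all integers $1\le u\le m$ and $1\le v\le n$, $$P_{(u,v)}=\sum_{t=u+v}^{m+n}\ \sum_{\substack{i+j=t\\ i\ge u,\ j\ge v}}(-1)^{i+j-(u+v)}\binom{i-1}{u-1}\binom{j-1}{v-1}S_{i,j},$$ and, for all integers $1\le i\le m$ and $1\le j\le n$, $$S_{i,j}=\sum_{u=i}^{m}\sum_{v=j}^{n}\binom{u-1}{i-1}\binom{v-1}{j-1}P_{(u,v)}.$$
   Context: For non-negative integers $a,r$, $\binom{a}{r}$ is the usual binomial coefficient, with $\binom{a}{0}=1$ and $\binom{a}{r}=0$ if $r>a$. In particular $S_{i,j}$ is zero if $i>m$ or $j>n$. $E$ denotes expectation. *)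

theory Defs
  imports "HOL-Probability.Probability"
begin

definition tail_prob :: "'a measure \<Rightarrow> ('a \<Rightarrow> nat) \<Rightarrow> ('a \<Rightarrow> nat) \<Rightarrow> nat \<Rightarrow> nat \<Rightarrow> real" where
  "tail_prob M S T u v = measure M {\<omega> \<in> space M. u \<le> S \<omega> \<and> v \<le> T \<omega>}"

definition binomial_moment :: "'a measure \<Rightarrow> ('a \<Rightarrow> nat) \<Rightarrow> ('a \<Rightarrow> nat) \<Rightarrow> nat \<Rightarrow> nat \<Rightarrow> real" where
  "binomial_moment M S T i j = prob_space.expectation M (\<lambda>\<omega>. real ((S \<omega> choose i) * (T \<omega> choose j)))"

end

theory Submission
  imports Defs
begin

text \<open>Both formulas are expectations of pointwise identities in \<open>(S, T)\<close>, and these are products of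
  one-variable identities: the indicator of \<open>u \<le> s\<close> is an alternating sum of \<open>s choose i\<close>, and
  conversely (hockey stick) \<open>s choose i\<close> is a sum of indicators of \<open>u \<le> s\<close>.\<close>

text \<open>Trinomial revision turns \<open>(s choose (a + k)) * ((a + k) choose a)\<close> into
  \<open>(s choose a) * ((s - a) choose k)\<close>. The factor free of \<open>k\<close> comes out,
  and what is left is the alternating sum of row \<open>s - a\<close> of Pascal's triangle, which
  vanishes unless \<open>s = a\<close>.\<close>

lemma choose_orthogonality:
  fixes a s K :: nat
  assumes "s < a + K"
  shows "(\<Sum>k<K. (-1) ^ k * real ((a + k) choose a) * real (s choose (a + k))) = of_bool (s = a)"
proof (cases "s < a")
  case False
  have "(\<Sum>k<K. (-1) ^ k * real ((a + k) choose a) * real (s choose (a + k)))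
      = (\<Sum>k<K. real (s choose a) * ((-1) ^ k * real ((s - a) choose k)))"
  proof (rule sum.cong)
    fix k
    have "(s choose (a + k)) * ((a + k) choose a) = (s choose a) * ((s - a) choose k)"
    proof (cases "a + k \<le> s")
      case True
      then show ?thesis
        using choose_mult[of a "a + k" s] by simp
    next
      case False
      then have "s < a \<or> s - a < k"
        by linarith
      with False show ?thesis
        by (auto simp: binomial_eq_0)
    qed
    then have "real (s choose (a + k)) * real ((a + k) choose a) = real (s choose a) * real ((s - a) choose k)"
      by (metis of_nat_mult)
    then show "(-1) ^ k * real ((a + k) choose a) * real (s choose (a + k))
        = real (s choose a) * ((-1) ^ k * real ((s - a) choose k))"
      by (simp add: mult.commute mult.left_commute)
  qed simp
  also have "\<dots> = real (s choose a) * (\<Sum>k<K. (-1) ^ k * real ((s - a) choose k))"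
    by (simp add: sum_distrib_left)
  \<comment> \<open>The hypothesis gives \<open>s - a < K\<close>, so the cut at \<open>K\<close>
    keeps the whole row and only adds zero terms beyond it.\<close>
  also have "(\<Sum>k<K. (-1) ^ k * real ((s - a) choose k)) = (\<Sum>k\<le>s - a. (-1) ^ k * real ((s - a) choose k))"
    using assms False by (intro sum.mono_neutral_right) (auto simp: binomial_eq_0)
  also have "\<dots> = of_bool (s = a)"
    using choose_alternating_sum[of "s - a", where ?'a = real] False by (cases "s = a") auto
  finally show ?thesis
    by simp
qed (simp add: binomial_eq_0)

text \<open>Induction on \<open>s\<close>: by Pascal's rule the sum grows from \<open>s\<close> to
  \<open>Suc s\<close> by exactly the orthogonality sum, which is 1 at \<open>s = a\<close> and 0
  elsewhere, just like the indicator of \<open>a < s\<close>. Here \<open>a\<close> stands for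
  \<open>u - 1\<close>, which keeps truncated subtraction out of the induction.\<close>

lemma of_bool_less_eq_alternating_choose_sum:
  fixes a s K :: nat
  assumes "s \<le> a + K"
  shows "(\<Sum>k<K. (-1) ^ k * real ((a + k) choose a) * real (s choose Suc (a + k))) = of_bool (a < s)"
  using assms
proof (induction s)
  case (Suc s)
  have "(\<Sum>k<K. (-1) ^ k * real ((a + k) choose a) * real (Suc s choose Suc (a + k)))
     = (\<Sum>k<K. (-1) ^ k * real ((a + k) choose a) * real (s choose (a + k)))
     + (\<Sum>k<K. (-1) ^ k * real ((a + k) choose a) * real (s choose Suc (a + k)))"
    by (simp add: sum.distrib[symmetric] algebra_simps)
  then show ?case
    using Suc choose_orthogonality[of s a K] by simp
qed simp

lemma of_bool_eq_alternating_choose_sum: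
  fixes u s m :: nat
  assumes "1 \<le> u" "u \<le> m" "s \<le> m"
  shows "of_bool (u \<le> s)
    = (\<Sum>i=u..m. (-1) ^ (i - u) * real ((i - 1) choose (u - 1)) * real (s choose i))"
proof -
  have "(\<Sum>i=u..m. (-1) ^ (i - u) * real ((i - 1) choose (u - 1)) * real (s choose i))
      = (\<Sum>k<Suc m - u. (-1) ^ k * real ((u - 1 + k) choose (u - 1)) * real (s choose Suc (u - 1 + k)))"
    \<comment> \<open>The shift is \<open>i = u + k\<close>. With \<open>a = u - 1\<close> and
      \<open>K = Suc m - u\<close> one has \<open>a + K = m\<close>, so the bound required on
      \<open>s\<close> is \<open>s \<le> m\<close>.\<close>
    using assms
    by (intro sum.reindex_bij_witness[of _ "\<lambda>k. u + k" "\<lambda>i. i - u"]) auto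
  also have "\<dots> = of_bool (u \<le> s)"
    using assms by (subst of_bool_less_eq_alternating_choose_sum) auto
  finally show ?thesis ..
qed

text \<open>Pascal's rule supplies the last summand when \<open>s\<close> grows by one. The
  indicator then lets the sum run to \<open>m\<close> instead of \<open>s\<close>, so that the range
  no longer depends on the random value and expectation can be taken term by term.\<close>

lemma choose_eq_sum_of_bool:
  fixes i s m :: nat
  assumes "1 \<le> i" "s \<le> m"
  shows "real (s choose i) = (\<Sum>u=i..m. real ((u - 1) choose (i - 1)) * of_bool (u \<le> s))"
proof -
  have "(s choose i) = (\<Sum>u=i..s. (u - 1) choose (i - 1))"
  proof (induction s)
    case (Suc s)
    obtain i' where "i = Suc i'"
      using assms(1) by (cases i) auto
    with Suc show ?case
      by (cases "i \<le> Suc s") (auto simp: binomial_eq_0)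
  qed (use assms in auto)
  then have "real (s choose i) = (\<Sum>u=i..s. real ((u - 1) choose (i - 1)))"
    by simp
  also have "\<dots> = (\<Sum>u=i..m. real ((u - 1) choose (i - 1)) * of_bool (u \<le> s))"
    using assms by (intro sum.mono_neutral_cong_left) auto
  finally show ?thesis .
qed

text \<open>An antidiagonal may leave the rectangle \<open>{u..m} \<times> {v..n}\<close>, but
  \<open>f\<close> vanishes there. What remains is the rectangle partitioned by the value of
  \<open>i + j\<close>, which lies between \<open>u + v\<close> and \<open>m + n\<close>.\<close>

lemma sum_antidiagonals:
  fixes f :: "nat \<Rightarrow> nat \<Rightarrow> real"
  assumes "\<And>i j. i > m \<or> j > n \<Longrightarrow> f i j = 0"
  shows "(\<Sum>t=u+v..m+n. \<Sum>(i, j)\<in>{(i, j). i + j = t \<and> i \<ge> u \<and> j \<ge> v}. f i j)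
    = (\<Sum>i=u..m. \<Sum>j=v..n. f i j)"
proof -
  let ?R = "{u..m} \<times> {v..n}"
  have bounds: "i \<le> m" "j \<le> n" if "f i j \<noteq> 0" for i j
    using assms[of i j] that by force+
  have "(\<Sum>(i, j)\<in>{(i, j). i + j = t \<and> i \<ge> u \<and> j \<ge> v}. f i j)
      = (\<Sum>(i, j)\<in>{p \<in> ?R. fst p + snd p = t}. f i j)" for t
  proof (rule sum.mono_neutral_right)
    show "finite {(i, j). i + j = t \<and> i \<ge> u \<and> j \<ge> v}"
      by (rule finite_subset[of _ "{..t} \<times> {..t}"]) auto
  qed (use bounds in auto)
  then have "(\<Sum>t=u+v..m+n. \<Sum>(i, j)\<in>{(i, j). i + j = t \<and> i \<ge> u \<and> j \<ge> v}. f i j)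
      = (\<Sum>t=u+v..m+n. \<Sum>(i, j)\<in>{p \<in> ?R. fst p + snd p = t}. f i j)"
    by simp
  also have "\<dots> = (\<Sum>(i, j)\<in>?R. f i j)"
    by (rule sum.group) auto
  finally show ?thesis
    by (simp add: sum.cartesian_product)
qed

theorem theorem2:
  fixes m n :: nat and M :: "'a measure" and S T :: "'a \<Rightarrow> nat"
  assumes "m \<ge> 1" and "n \<ge> 1"
    and "prob_space M"
    and "(\<lambda>\<omega>. (S \<omega>, T \<omega>)) \<in> measurable M (count_space ({0..m} \<times> {0..n}))"
  shows "(\<forall>u\<in>{1..m}. \<forall>v\<in>{1..n}.
            tail_prob M S T u v =
              (\<Sum>t=u+v..m+n. \<Sum>(i, j)\<in>{(i, j). i + j = t \<and> i \<ge> u \<and> j \<ge> v}.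
                 (-1) ^ (i + j - (u + v)) * real ((i - 1) choose (u - 1)) * real ((j - 1) choose (v - 1))
                 * binomial_moment M S T i j)) \<and>
         (\<forall>i\<in>{1..m}. \<forall>j\<in>{1..n}.
            binomial_moment M S T i j =
              (\<Sum>u=i..m. \<Sum>v=j..n.
                 real ((u - 1) choose (i - 1)) * real ((v - 1) choose (j - 1)) * tail_prob M S T u v))"
proof -
  interpret prob_space M by fact
  note meas = assms(4)
  have range: "S \<omega> \<le> m" "T \<omega> \<le> n" if "\<omega> \<in> space M" for \<omega>
    using measurable_space[OF meas that] by auto
  \<comment> \<open>The pair takes finitely many values, so the sum of all
    \<open>norm (f i j)\<close> over the grid is a constant bound. Measurability is automatic
    because every function on a \<open>count_space\<close> is measurable.\<close>
  have integrable_comp: "integrable M (\<lambda>\<omega>. f (S \<omega>) (T \<omega>))" for f :: "nat \<Rightarrow> nat \<Rightarrow> real"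
  proof (rule integrable_const_bound)
    have "(\<lambda>\<omega>. case_prod f (S \<omega>, T \<omega>)) \<in> borel_measurable M"
      by (rule measurable_compose[OF meas]) simp
    then show "(\<lambda>\<omega>. f (S \<omega>) (T \<omega>)) \<in> borel_measurable M"
      by simp
    have "norm (f (S \<omega>) (T \<omega>)) \<le> (\<Sum>i\<le>m. \<Sum>j\<le>n. norm (f i j))" if "\<omega> \<in> space M" for \<omega>
    proof -
      have "norm (f (S \<omega>) (T \<omega>)) \<le> (\<Sum>j\<le>n. norm (f (S \<omega>) j))"
        using range[OF that] by (intro member_le_sum) auto
      also have "\<dots> \<le> (\<Sum>i\<le>m. \<Sum>j\<le>n. norm (f i j))"
        using range[OF that]
        by (intro member_le_sum[where f = "\<lambda>i. \<Sum>j\<le>n. norm (f i j)"]) (auto intro: sum_nonneg)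
      finally show ?thesis .
    qed
    then show "AE \<omega> in M. norm (f (S \<omega>) (T \<omega>)) \<le> (\<Sum>i\<le>m. \<Sum>j\<le>n. norm (f i j))"
      by (intro AE_I2)
  qed
  have expectation_sum: "expectation (\<lambda>\<omega>. \<Sum>i\<in>A. \<Sum>j\<in>B. c i j * f i j (S \<omega>) (T \<omega>))
      = (\<Sum>i\<in>A. \<Sum>j\<in>B. c i j * expectation (\<lambda>\<omega>. f i j (S \<omega>) (T \<omega>)))"
    for A B :: "nat set" and c and f :: "nat \<Rightarrow> nat \<Rightarrow> nat \<Rightarrow> nat \<Rightarrow> real"
    by (simp add: Bochner_Integration.integral_sum integrable_comp)
  have tail: "tail_prob M S T u v = expectation (\<lambda>\<omega>. of_bool (u \<le> S \<omega>) * of_bool (v \<le> T \<omega>))" for u v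
  proof -
    \<comment> \<open>Measurability is given for the joint map only, so the event is written as the
      preimage of a rectangle inside the value grid.\<close>
    have "(\<lambda>\<omega>. (S \<omega>, T \<omega>)) -` ({u..m} \<times> {v..n}) \<inter> space M \<in> events"
      by (rule measurable_sets[OF meas]) auto
    also have "(\<lambda>\<omega>. (S \<omega>, T \<omega>)) -` ({u..m} \<times> {v..n}) \<inter> space M
        = {\<omega> \<in> space M. u \<le> S \<omega> \<and> v \<le> T \<omega>}"
      using range by auto
    finally have "{\<omega> \<in> space M. u \<le> S \<omega> \<and> v \<le> T \<omega>} \<in> events" .
    then have "tail_prob M S T u v = expectation (indicator {\<omega> \<in> space M. u \<le> S \<omega> \<and> v \<le> T \<omega>})"
      by (simp add: tail_prob_def)
    also have "\<dots> = expectation (\<lambda>\<omega>. of_bool (u \<le> S \<omega>) * of_bool (v \<le> T \<omega>))"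
      by (intro Bochner_Integration.integral_cong) (auto simp: indicator_def)
    finally show ?thesis .
  qed
  have moment: "binomial_moment M S T i j = expectation (\<lambda>\<omega>. real (S \<omega> choose i) * real (T \<omega> choose j))" for i j
    by (simp add: binomial_moment_def)
  \<comment> \<open>This is the vanishing hypothesis of \<open>sum_antidiagonals\<close>.\<close>
  have moment_0: "binomial_moment M S T i j = 0" if "i > m \<or> j > n" for i j
  proof -
    have "binomial_moment M S T i j = expectation (\<lambda>\<omega>. 0)"
      unfolding moment using that range
      by (intro Bochner_Integration.integral_cong refl) (fastforce simp: binomial_eq_0)
    then show ?thesis
      by simp
  qed
  have "tail_prob M S T u v =
      (\<Sum>t=u+v..m+n. \<Sum>(i, j)\<in>{(i, j). i + j = t \<and> i \<ge> u \<and> j \<ge> v}.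
         (-1) ^ (i + j - (u + v)) * real ((i - 1) choose (u - 1)) * real ((j - 1) choose (v - 1))
         * binomial_moment M S T i j)"
    if uv: "u \<in> {1..m}" "v \<in> {1..n}" for u v
  proof -
    let ?c = "\<lambda>i j. (-1) ^ (i + j - (u + v)) * real ((i - 1) choose (u - 1)) * real ((j - 1) choose (v - 1))"
    have "tail_prob M S T u v = expectation (\<lambda>\<omega>. \<Sum>i=u..m. \<Sum>j=v..n.
        ?c i j * (real (S \<omega> choose i) * real (T \<omega> choose j)))"
      unfolding tail
    proof (rule Bochner_Integration.integral_cong)
      fix \<omega> assume \<omega>: "\<omega> \<in> space M"
      \<comment> \<open>The range restriction matters: truncated subtraction gives
        \<open>i + j - (u + v) = (i - u) + (j - v)\<close> because \<open>u \<le> i\<close> and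
        \<open>v \<le> j\<close>.\<close>
      have sign: "(-1::real) ^ (i + j - (u + v)) = (-1) ^ (i - u) * (-1) ^ (j - v)"
        if "i \<in> {u..m}" "j \<in> {v..n}" for i j
        using that by (simp flip: power_add)
      have "of_bool (u \<le> S \<omega>) * (of_bool (v \<le> T \<omega>) :: real)
          = (\<Sum>i=u..m. (-1) ^ (i - u) * real ((i - 1) choose (u - 1)) * real (S \<omega> choose i))
          * (\<Sum>j=v..n. (-1) ^ (j - v) * real ((j - 1) choose (v - 1)) * real (T \<omega> choose j))"
        using of_bool_eq_alternating_choose_sum[of u m "S \<omega>"]
          of_bool_eq_alternating_choose_sum[of v n "T \<omega>"] uv range[OF \<omega>] by simp
      also have "\<dots> = (\<Sum>i=u..m. \<Sum>j=v..n. ?c i j * (real (S \<omega> choose i) * real (T \<omega> choose j)))"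
        unfolding sum_product by (intro sum.cong refl) (simp add: sign mult_ac)
      finally show "of_bool (u \<le> S \<omega>) * (of_bool (v \<le> T \<omega>) :: real) = \<dots>" .
    qed simp
    also have "\<dots> = (\<Sum>i=u..m. \<Sum>j=v..n. ?c i j * binomial_moment M S T i j)"
      unfolding moment by (rule expectation_sum)
    also have "\<dots> = (\<Sum>t=u+v..m+n. \<Sum>(i, j)\<in>{(i, j). i + j = t \<and> i \<ge> u \<and> j \<ge> v}.
        ?c i j * binomial_moment M S T i j)"
      by (rule sum_antidiagonals[symmetric]) (simp add: moment_0)
    finally show ?thesis .
  qed
  moreover have "binomial_moment M S T i j =
      (\<Sum>u=i..m. \<Sum>v=j..n.
         real ((u - 1) choose (i - 1)) * real ((v - 1) choose (j - 1)) * tail_prob M S T u v)"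
    if ij: "i \<in> {1..m}" "j \<in> {1..n}" for i j
  proof -
    let ?c = "\<lambda>u v. real ((u - 1) choose (i - 1)) * real ((v - 1) choose (j - 1))"
    have "binomial_moment M S T i j = expectation (\<lambda>\<omega>. \<Sum>u=i..m. \<Sum>v=j..n.
        ?c u v * (of_bool (u \<le> S \<omega>) * of_bool (v \<le> T \<omega>)))"
      unfolding moment
    proof (rule Bochner_Integration.integral_cong)
      fix \<omega> assume \<omega>: "\<omega> \<in> space M"
      \<comment> \<open>The hockey stick identity is applied to each factor at the fixed outcome;
        independence of \<open>S\<close> and \<open>T\<close> is not involved, since the product is
        expanded before expectation is taken.\<close>
      have "real (S \<omega> choose i) * real (T \<omega> choose j)
          = (\<Sum>u=i..m. real ((u - 1) choose (i - 1)) * of_bool (u \<le> S \<omega>))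
          * (\<Sum>v=j..n. real ((v - 1) choose (j - 1)) * of_bool (v \<le> T \<omega>))"
        using choose_eq_sum_of_bool[of i "S \<omega>" m] choose_eq_sum_of_bool[of j "T \<omega>" n]
          ij range[OF \<omega>] by simp
      also have "\<dots> = (\<Sum>u=i..m. \<Sum>v=j..n. ?c u v * (of_bool (u \<le> S \<omega>) * of_bool (v \<le> T \<omega>)))"
        unfolding sum_product by (intro sum.cong refl) (simp only: mult_ac)
      finally show "real (S \<omega> choose i) * real (T \<omega> choose j) = \<dots>" .
    qed simp
    also have "\<dots> = (\<Sum>u=i..m. \<Sum>v=j..n. ?c u v * tail_prob M S T u v)"
      unfolding tail by (rule expectation_sum)
    finally show ?thesis .
  qed
  ultimately show ?thesis
    by blast
qed

end
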